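(* Let $G_1$ and $G_2$ be two connected graphs with $m\geq 1$ and $n\geq 1$ vertices, respectively. Then $$\max\{n\,\mathrm{QEC}(G_1),\ m\,\mathrm{QEC}(G_2)\}\leq\mathrm{QEC}(G_1\times G_2).$$
   Context: All graphs are finite, simple and unweighted. For a connected graph $G=(V,E)$, $D_G$ is its distance matrix (the $(v,w)$ entry is the length of a shortest path connecting $v$ and $w$, with zero diagonal), and the quadratic embedding constant is $\mathrm{QEC}(G):=\max\{\langle f,D_Gf\rangle : f\in C(V),\ \langle f,f\rangle=1,\ \langle e,f\rangle=0\}$, where $C(V)\cong\mathbb{R}^{|V|}$ is the space of real-valued functions on $V$, $e$ is the constant function with value $1$, and $\langle\cdot,\cdot\rangle$ is the canonical inner product. The Cartesian product $G_1\times G_2$ of $G_1=(V_1,E_1)$ and $G_2=(V_2,E_2)$ has vertex set $V_1\times V_2$, with $(u,v)$ and $(u',v')$ adjacent if and only if either $u\sim u'$ in $G_1$ and $v=v'$, or $u=u'$ and $v\sim v'$ in $G_2$. *)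

theory Defs
  imports "HOL-Analysis.Analysis" "Graph_Theory.Graph_Theory"
begin

text \<open>
  A finite simple graph is a \<open>pair_graph\<close>: a finite, loop-free, symmetric relation on
  a finite vertex set. \<open>connected\<close> always means the graph-theoretic notion
  \<open>Digraph_Component.connected\<close>, which in particular excludes the empty graph.
\<close>

definition graph_dist :: "'a pair_pre_digraph \<Rightarrow> 'a \<Rightarrow> 'a \<Rightarrow> real" where
  "graph_dist G v w = real_of_ereal (wf_digraph.\<mu> (with_proj G) (\<lambda>_. 1) v w)"

text \<open>
  Elements of \<open>C(V)\<close> are represented by total functions whose values outside \<open>V\<close>
  are ignored by everything below.
\<close>

definition inner_on :: "'a set \<Rightarrow> ('a \<Rightarrow> real) \<Rightarrow> ('a \<Rightarrow> real) \<Rightarrow> real" where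
  "inner_on V f g = (\<Sum>v\<in>V. f v * g v)"

definition dist_op :: "'a pair_pre_digraph \<Rightarrow> ('a \<Rightarrow> real) \<Rightarrow> 'a \<Rightarrow> real" where
  "dist_op G f v = (\<Sum>w\<in>pverts G. graph_dist G v w * f w)"

definition qec_feasible :: "'a pair_pre_digraph \<Rightarrow> ('a \<Rightarrow> real) set" where
  "qec_feasible G =
     {f. inner_on (pverts G) f f = 1 \<and> inner_on (pverts G) (\<lambda>_. 1) f = 0}"

text \<open>
  For a graph with one vertex no \<open>f\<close> is feasible; the maximum of the empty set is read as
  \<open>-\<infinity>\<close>, which is why the value is an extended real. With at least two vertices the
  supremum is a (finite) maximum, see \<open>QEC_is_max\<close> below.
\<close>

definition QEC :: "'a pair_pre_digraph \<Rightarrow> ereal" where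
  "QEC G = (SUP f\<in>qec_feasible G. ereal (inner_on (pverts G) f (dist_op G f)))"

definition cartesian_product ::
  "'a pair_pre_digraph \<Rightarrow> 'b pair_pre_digraph \<Rightarrow> ('a \<times> 'b) pair_pre_digraph" where
  "cartesian_product G1 G2 =
     \<lparr> pverts = pverts G1 \<times> pverts G2,
       parcs = {((u, v), (u', v')) | u v u' v'.
         (u, v) \<in> pverts G1 \<times> pverts G2 \<and> (u', v') \<in> pverts G1 \<times> pverts G2 \<and>
         ((u, u') \<in> parcs G1 \<and> v = v' \<or> u = u' \<and> (v, v') \<in> parcs G2)} \<rparr>"


lemma graph_dist_least_walk_length:
  assumes "pair_graph G" and conn: "Digraph_Component.connected (with_proj G)"
    and "v \<in> pverts G" "w \<in> pverts G"
  shows "\<exists>p. pre_digraph.apath (with_proj G) v p w \<and> graph_dist G v w = real (length p)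
    \<and> (\<forall>q. pre_digraph.awalk (with_proj G) v q w \<longrightarrow> length p \<le> length q)"
proof -
  interpret pair_graph G by fact
  have cost: "awalk_cost (\<lambda>_. 1) p = real (length p)" for p
    by (induction p) auto
  have "strongly_connected (with_proj G)"
    using conn symmetric_connected_imp_strongly_connected by blast
  then have "v \<rightarrow>\<^sup>*\<^bsub>with_proj G\<^esub> w"
    using assms by (auto simp: strongly_connected_def)
  then obtain p where p: "apath v p w" "\<mu> (\<lambda>_. 1) v w = awalk_cost (\<lambda>_. 1) p"
    using min_cost_awalk[of v w "\<lambda>_. 1"] by auto
  moreover have "length p \<le> length q" if "awalk v q w" for q
    using min_cost_le_walk_cost[OF that, of "\<lambda>_. 1"] p(2) by (simp add: cost)
  ultimately show ?thesis
    by (auto simp: graph_dist_def cost)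
qed

lemma pair_graph_cartesian_product:
  assumes "pair_graph G1" "pair_graph G2"
  shows "pair_graph (cartesian_product G1 G2)"
proof -
  interpret A: pair_graph G1 by fact
  interpret B: pair_graph G2 by fact
  let ?V = "pverts G1 \<times> pverts G2"
  have "parcs (cartesian_product G1 G2) \<subseteq> ?V \<times> ?V"
    by (auto simp: cartesian_product_def)
  then have "finite (parcs (cartesian_product G1 G2))"
    by (rule finite_subset) (simp add: A.pair_finite_verts B.pair_finite_verts)
  moreover have "finite (pverts (cartesian_product G1 G2))"
    by (simp add: cartesian_product_def A.pair_finite_verts B.pair_finite_verts)
  moreover have "sym (parcs (cartesian_product G1 G2))"
    unfolding cartesian_product_def
    by (rule symI) (use A.arcs_symmetric B.arcs_symmetric in simp, blast)
  moreover have "fst e \<noteq> snd e" if "e \<in> parcs (cartesian_product G1 G2)" for e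
    using that A.no_loops' B.no_loops' by (fastforce simp: cartesian_product_def)
  moreover have "fst e \<in> pverts (cartesian_product G1 G2) \<and> snd e \<in> pverts (cartesian_product G1 G2)"
    if "e \<in> parcs (cartesian_product G1 G2)" for e
    using that by (auto simp: cartesian_product_def)
  ultimately show ?thesis
    by unfold_locales (simp_all add: symmetric_def)
qed

lemma QEC_is_max:
  assumes fin: "finite (pverts G)" and two: "card (pverts G) \<ge> 2"
  shows "\<exists>f\<in>qec_feasible G. QEC G = ereal (inner_on (pverts G) f (dist_op G f))
    \<and> (\<forall>g\<in>qec_feasible G. inner_on (pverts G) g (dist_op G g) \<le> inner_on (pverts G) f (dist_op G f))"
proof -
  let ?V = "pverts G"
  let ?Q = "\<lambda>f. inner_on ?V f (dist_op G f)"
  let ?r = "\<lambda>f v. if v \<in> ?V then f v else 0"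
  define K where "K = {f. (\<forall>v. v \<notin> ?V \<longrightarrow> f v = 0) \<and> f \<in> qec_feasible G}"
  have r: "?r f \<in> K \<and> ?Q (?r f) = ?Q f" if "f \<in> qec_feasible G" for f
    using that by (auto simp: K_def qec_feasible_def inner_on_def dist_op_def cong: sum.cong)
  have cont: "continuous_on UNIV (\<lambda>f::'a \<Rightarrow> real. f v)" for v
    by (rule continuous_on_product_coordinates)
  have "K \<subseteq> (\<Pi>\<^sub>E v\<in>UNIV. {-1..1})"
  proof
    fix f assume f: "f \<in> K"
    have "f v \<in> {-1..1}" for v
    proof (cases "v \<in> ?V")
      case True
      have "f v * f v \<le> (\<Sum>v\<in>?V. f v * f v)"
        using True fin by (intro member_le_sum) auto
      also have "\<dots> = 1" using f by (simp add: K_def qec_feasible_def inner_on_def)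
      finally have "(f v)\<^sup>2 \<le> 1" by (simp add: power2_eq_square)
      then have "\<bar>f v\<bar> \<le> 1" by (simp add: abs_square_le_1)
      then show ?thesis by (simp add: abs_le_iff)
    qed (use f in \<open>auto simp: K_def\<close>)
    then show "f \<in> (\<Pi>\<^sub>E v\<in>UNIV. {-1..1})" by auto
  qed
  moreover have "compact (\<Pi>\<^sub>E v\<in>(UNIV::'a set). {-1..1::real})"
  proof -
    have "compactin (product_topology (\<lambda>i. euclidean) UNIV) (\<Pi>\<^sub>E v\<in>(UNIV::'a set). {-1..1::real})"
      by (simp add: compactin_PiE)
    then show ?thesis by (simp only: euclidean_product_topology compactin_euclidean_iff)
  qed
  moreover have "closed K"
  proof -
    have 1: "closed {f::'a \<Rightarrow> real. f v = 0}" for v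
      by (intro closed_Collect_eq continuous_intros cont)
    have "closed (\<Inter>v\<in>-?V. {f::'a \<Rightarrow> real. f v = 0})"
      using 1 by blast
    moreover have "closed {f::'a \<Rightarrow> real. inner_on ?V f f = 1}"
      unfolding inner_on_def by (intro closed_Collect_eq continuous_intros cont)
    moreover have "closed {f::'a \<Rightarrow> real. inner_on ?V (\<lambda>_. 1) f = 0}"
      unfolding inner_on_def by (intro closed_Collect_eq continuous_intros cont)
    ultimately have "closed ((\<Inter>v\<in>-?V. {f. f v = 0}) \<inter> {f. inner_on ?V f f = 1}
       \<inter> {f. inner_on ?V (\<lambda>_. 1) f = 0})" by blast
    also have "\<dots> = K" by (auto simp: K_def qec_feasible_def)
    finally show ?thesis .
  qed
  ultimately have "compact K"
    using compact_Int_closed[of "\<Pi>\<^sub>E v\<in>(UNIV::'a set). {-1..1::real}" K] by (simp add: inf.absorb2)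
  moreover have "K \<noteq> {}"
  proof -
    obtain a b where ab: "a \<in> ?V" "b \<in> ?V" "a \<noteq> b"
      using two fin by (metis card_le_Suc0_iff_eq not_less_eq_eq numeral_2_eq_2)
    define f where "f v = (if v = a then 1 / sqrt 2 else if v = b then - (1 / sqrt 2) else 0)" for v
    have "f \<in> qec_feasible G"
    proof -
      have "(\<Sum>v\<in>?V. f v * f v) = (\<Sum>v\<in>{a, b}. f v * f v)"
        using ab fin by (intro sum.mono_neutral_right) (auto simp: f_def)
      moreover have "(\<Sum>v\<in>?V. f v) = (\<Sum>v\<in>{a, b}. f v)"
        using ab fin by (intro sum.mono_neutral_right) (auto simp: f_def)
      ultimately show ?thesis
        using ab by (simp add: qec_feasible_def inner_on_def f_def)
    qed
    then show ?thesis using r by blast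
  qed
  moreover have "continuous_on K ?Q"
    unfolding inner_on_def dist_op_def
    by (intro continuous_intros continuous_on_subset[OF cont]) auto
  ultimately obtain f where f: "f \<in> K" "\<forall>g\<in>K. ?Q g \<le> ?Q f"
    using continuous_attains_sup[of K ?Q] by blast
  have mx: "\<forall>g\<in>qec_feasible G. ?Q g \<le> ?Q f"
    proof
    fix g assume "g \<in> qec_feasible G"
    then have "?r g \<in> K" "?Q (?r g) = ?Q g" using r by blast+
    then show "?Q g \<le> ?Q f" using f(2) by force
  qed
  moreover have fe: "f \<in> qec_feasible G" using f(1) by (simp add: K_def)
  moreover have "QEC G = ereal (?Q f)"
    unfolding QEC_def using mx fe by (intro SUP_eqI) auto
  ultimately show ?thesis by blast
qed

end

theory Submission
  imports Defs
begin

text \<open>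
  The distance matrix of a Cartesian product is a Kronecker sum: a step of a walk moves exactly one
  coordinate, so walks of length \<open>k\<close> in the product are interleavings of a walk of length \<open>i\<close> in
  \<open>G1\<close> and one of length \<open>j\<close> in \<open>G2\<close> with \<open>i + j = k\<close>. Minimizing over \<open>i\<close> and \<open>j\<close>
  independently gives \<open>d((u,v),(u',v')) = d(u,u') + d(v,v')\<close> (\<open>graph_dist_cartesian_product\<close>).

  The quadratic form of such a sum at a tensor \<open>F(u,v) = a u * b v\<close> is therefore
  \<open>\<langle>a, D1 a\<rangle> (\<Sum>b)\<^sup>2 + (\<Sum>a)\<^sup>2 \<langle>b, D2 b\<rangle>\<close> (\<open>quadratic_form_tensor\<close>). Let \<open>a\<close> be feasible for
  \<open>G1\<close>, so that \<open>\<Sum>a = 0\<close>, and let \<open>b\<close> be the constant unit vector on the \<open>n\<close> vertices of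
  \<open>G2\<close>. Then \<open>F\<close> is feasible for the product, and since \<open>(\<Sum>b)\<^sup>2 = n\<close> its value is
  \<open>n \<langle>a, D1 a\<rangle>\<close>. Taking the supremum over \<open>a\<close> bounds \<open>n QEC G1\<close>; exchanging the roles of
  \<open>a\<close> and \<open>b\<close> bounds \<open>m QEC G2\<close>.
\<close>

section \<open>Walks and distances in a Cartesian product\<close>

text \<open>
  Relation powers forget the vertices that a walk visits, which leaves exactly what distances need:
  the splitting of a walk in the product becomes an induction on the exponent.
\<close>

lemma (in pair_wf_digraph) relpow_parcs_iff_awalk:
  assumes "v \<in> pverts G"
  shows "(v, w) \<in> parcs G ^^ k \<longleftrightarrow> (\<exists>p. awalk v p w \<and> length p = k)"
  using assms
proof (induction k arbitrary: v)
  case 0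
  then show ?case by (auto simp: awalk_Nil_iff)
next
  case (Suc k)
  show ?case
  proof
    assume "(v, w) \<in> parcs G ^^ Suc k"
    then obtain x where x: "(v, x) \<in> parcs G" "(x, w) \<in> parcs G ^^ k"
      by (meson relpow_Suc_D2)
    moreover have "x \<in> pverts G" using x(1) in_arcsD2 by blast
    ultimately obtain p where "awalk x p w" "length p = k"
      using Suc.IH by blast
    with x(1) show "\<exists>p. awalk v p w \<and> length p = Suc k"
      by (intro exI[of _ "(v, x) # p"]) (auto simp: awalk_Cons_iff)
  next
    assume "\<exists>p. awalk v p w \<and> length p = Suc k"
    then obtain e p where "awalk v (e # p) w" "length p = k"
      by (auto simp: length_Suc_conv)
    then have "(v, snd e) \<in> parcs G" "awalk (snd e) p w"
      by (auto simp: awalk_Cons_iff)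
    moreover from this have "snd e \<in> pverts G" using in_arcsD2 by blast
    ultimately show "(v, w) \<in> parcs G ^^ Suc k"
      using Suc.IH \<open>length p = k\<close> by (blast intro: relpow_Suc_I2)
  qed
qed

lemma graph_dist_eqI:
  assumes "pair_wf_digraph G" and v: "v \<in> pverts G"
    and walk: "(v, w) \<in> parcs G ^^ k"
    and least: "\<And>j. (v, w) \<in> parcs G ^^ j \<Longrightarrow> k \<le> j"
  shows "graph_dist G v w = real k"
proof -
  interpret pair_wf_digraph G by fact
  have cost: "awalk_cost (\<lambda>_. 1) p = real (length p)" for p
    by (induction p) auto
  have "\<mu> (\<lambda>_. 1) v w = ereal (real k)"
    unfolding \<mu>_def
  proof (rule antisym)
    obtain p where "awalk v p w" "length p = k"
      using walk relpow_parcs_iff_awalk[OF v] by blast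
    then show "(INF p\<in>{p. awalk v p w}. ereal (awalk_cost (\<lambda>_. 1) p)) \<le> ereal (real k)"
      by (intro INF_lower2[of p]) (auto simp: cost)
  next
    show "ereal (real k) \<le> (INF p\<in>{p. awalk v p w}. ereal (awalk_cost (\<lambda>_. 1) p))"
      using least relpow_parcs_iff_awalk[OF v] by (intro INF_greatest) (auto simp: cost)
  qed
  then show ?thesis by (simp add: graph_dist_def)
qed

lemma graph_dist_least_relpow:
  assumes "pair_graph G" and "Digraph_Component.connected (with_proj G)"
    and v: "v \<in> pverts G" and "w \<in> pverts G"
  shows "\<exists>k. graph_dist G v w = real k \<and> (v, w) \<in> parcs G ^^ k
    \<and> (\<forall>j. (v, w) \<in> parcs G ^^ j \<longrightarrow> k \<le> j)"
proof -
  interpret pair_graph G by fact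
  obtain p where p: "apath v p w" "graph_dist G v w = real (length p)"
      "\<forall>q. awalk v q w \<longrightarrow> length p \<le> length q"
    using graph_dist_least_walk_length[OF assms] by blast
  show ?thesis
  proof (intro exI[of _ "length p"] conjI)
    show "(v, w) \<in> parcs G ^^ length p"
      unfolding relpow_parcs_iff_awalk[OF v] using awalkI_apath[OF p(1)] by blast
    show "\<forall>j. (v, w) \<in> parcs G ^^ j \<longrightarrow> length p \<le> j"
      unfolding relpow_parcs_iff_awalk[OF v] using p(3) by blast
  qed (rule p(2))
qed

text \<open>
  A step of the product changes one coordinate and keeps the other, so a walk splits into its two
  coordinate walks, whose lengths add up; conversely one can first walk in the first coordinate and
  then in the second.
\<close>

lemma relpow_cartesian_product_iff:
  assumes "pair_wf_digraph G1" "pair_wf_digraph G2"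
    and "u \<in> pverts G1" "v \<in> pverts G2"
  shows "((u, v), (u', v')) \<in> parcs (cartesian_product G1 G2) ^^ k \<longleftrightarrow>
    (\<exists>i j. i + j = k \<and> (u, u') \<in> parcs G1 ^^ i \<and> (v, v') \<in> parcs G2 ^^ j)"
    (is "?walk k u v \<longleftrightarrow> ?split k u v")
  using assms(3,4)
proof (induction k arbitrary: u v)
  case 0
  then show ?case by auto
next
  case (Suc k)
  interpret A: pair_wf_digraph G1 by fact
  interpret B: pair_wf_digraph G2 by fact
  have step: "((u, v), (x, y)) \<in> parcs (cartesian_product G1 G2) \<longleftrightarrow>
      (u, x) \<in> parcs G1 \<and> v = y \<or> u = x \<and> (v, y) \<in> parcs G2" for x y
    using Suc.prems A.in_arcsD2 B.in_arcsD2 by (auto simp: cartesian_product_def)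
  have first: "?walk k x v \<longleftrightarrow> ?split k x v" if "(u, x) \<in> parcs G1" for x
    using Suc.IH[of x v] Suc.prems A.in_arcsD2[OF that] by blast
  have second: "?walk k u y \<longleftrightarrow> ?split k u y" if "(v, y) \<in> parcs G2" for y
    using Suc.IH[of u y] Suc.prems B.in_arcsD2[OF that] by blast
  have "?walk (Suc k) u v \<longleftrightarrow>
      (\<exists>x y. ((u, v), (x, y)) \<in> parcs (cartesian_product G1 G2) \<and> ?walk k x y)"
    by (metis relpow_Suc_D2 relpow_Suc_I2 surj_pair)
  also have "\<dots> \<longleftrightarrow> (\<exists>x. (u, x) \<in> parcs G1 \<and> ?walk k x v) \<or> (\<exists>y. (v, y) \<in> parcs G2 \<and> ?walk k u y)"
    unfolding step by blast
  also have "\<dots> \<longleftrightarrow> (\<exists>x. (u, x) \<in> parcs G1 \<and> ?split k x v) \<or> (\<exists>y. (v, y) \<in> parcs G2 \<and> ?split k u y)"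
    using first second by blast
  also have "\<dots> \<longleftrightarrow> ?split (Suc k) u v"
  proof
    assume "(\<exists>x. (u, x) \<in> parcs G1 \<and> ?split k x v) \<or> (\<exists>y. (v, y) \<in> parcs G2 \<and> ?split k u y)"
    then show "?split (Suc k) u v"
    proof (elim disjE exE conjE)
      fix x i j
      assume "(u, x) \<in> parcs G1" "i + j = k" "(x, u') \<in> parcs G1 ^^ i" "(v, v') \<in> parcs G2 ^^ j"
      then show "?split (Suc k) u v"
        by (intro exI[of _ "Suc i"] exI[of _ j]) (auto intro: relpow_Suc_I2 simp del: relpow.simps)
    next
      fix y i j
      assume "(v, y) \<in> parcs G2" "i + j = k" "(u, u') \<in> parcs G1 ^^ i" "(y, v') \<in> parcs G2 ^^ j"
      then show "?split (Suc k) u v"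
        by (intro exI[of _ i] exI[of _ "Suc j"]) (auto intro: relpow_Suc_I2 simp del: relpow.simps)
    qed
  next
    assume "?split (Suc k) u v"
    then obtain i j where ij: "i + j = Suc k" "(u, u') \<in> parcs G1 ^^ i" "(v, v') \<in> parcs G2 ^^ j"
      by blast
    show "(\<exists>x. (u, x) \<in> parcs G1 \<and> ?split k x v) \<or> (\<exists>y. (v, y) \<in> parcs G2 \<and> ?split k u y)"
    proof (cases i)
      case 0
      then have "j = Suc k" using ij by simp
      then obtain y where "(v, y) \<in> parcs G2" "(y, v') \<in> parcs G2 ^^ k"
        using ij(3) by (meson relpow_Suc_D2)
      then show ?thesis using 0 ij(2) by (metis add_0)
    next
      case (Suc i')
      then obtain x where "(u, x) \<in> parcs G1" "(x, u') \<in> parcs G1 ^^ i'"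
        using ij(2) by (meson relpow_Suc_D2)
      moreover have "i' + j = k" using Suc ij(1) by simp
      ultimately show ?thesis using ij(3) by blast
    qed
  qed
  finally show ?case .
qed

lemma graph_dist_cartesian_product:
  assumes G1: "pair_graph G1" "Digraph_Component.connected (with_proj G1)"
    and G2: "pair_graph G2" "Digraph_Component.connected (with_proj G2)"
    and u: "u \<in> pverts G1" "u' \<in> pverts G1" and v: "v \<in> pverts G2" "v' \<in> pverts G2"
  shows "graph_dist (cartesian_product G1 G2) (u, v) (u', v') =
    graph_dist G1 u u' + graph_dist G2 v v'"
proof -
  interpret A: pair_graph G1 by fact
  interpret B: pair_graph G2 by fact
  interpret P: pair_graph "cartesian_product G1 G2"
    using G1(1) G2(1) by (rule pair_graph_cartesian_product)
  note split = relpow_cartesian_product_iff[OF A.pair_wf_digraph_axioms B.pair_wf_digraph_axioms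
      u(1) v(1), of u' v']
  obtain i where i: "graph_dist G1 u u' = real i" "(u, u') \<in> parcs G1 ^^ i"
      "\<forall>k. (u, u') \<in> parcs G1 ^^ k \<longrightarrow> i \<le> k"
    using graph_dist_least_relpow[OF G1 u] by blast
  obtain j where j: "graph_dist G2 v v' = real j" "(v, v') \<in> parcs G2 ^^ j"
      "\<forall>k. (v, v') \<in> parcs G2 ^^ k \<longrightarrow> j \<le> k"
    using graph_dist_least_relpow[OF G2 v] by blast
  have "graph_dist (cartesian_product G1 G2) (u, v) (u', v') = real (i + j)"
  proof (rule graph_dist_eqI[OF P.pair_wf_digraph_axioms])
    show "(u, v) \<in> pverts (cartesian_product G1 G2)"
      using u v by (simp add: cartesian_product_def)
    show "((u, v), (u', v')) \<in> parcs (cartesian_product G1 G2) ^^ (i + j)"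
      unfolding split using i(2) j(2) by blast
    show "i + j \<le> k" if "((u, v), (u', v')) \<in> parcs (cartesian_product G1 G2) ^^ k" for k
      using that i(3) j(3) unfolding split by (auto intro: add_mono)
  qed
  then show ?thesis by (simp add: i(1) j(1))
qed

section \<open>The quadratic form at a tensor\<close>

lemma pverts_cartesian_product [simp]:
  "pverts (cartesian_product G1 G2) = pverts G1 \<times> pverts G2"
  by (simp add: cartesian_product_def)

definition tensor :: "('a \<Rightarrow> real) \<Rightarrow> ('b \<Rightarrow> real) \<Rightarrow> 'a \<times> 'b \<Rightarrow> real" where
  "tensor a b = (\<lambda>(u, v). a u * b v)"

lemma inner_on_tensor:
  "inner_on (V \<times> W) (tensor a b) (tensor a' b') = inner_on V a a' * inner_on W b b'"
  by (simp add: inner_on_def tensor_def sum.cartesian_product' sum_product mult_ac)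

lemma inner_on_add_right:
  "inner_on V f (\<lambda>x. g x + h x) = inner_on V f g + inner_on V f h"
  by (simp add: inner_on_def distrib_left sum.distrib)

lemma inner_on_scale_right:
  "inner_on V f (\<lambda>x. c * g x) = c * inner_on V f g"
  by (simp add: inner_on_def sum_distrib_left mult_ac)

text \<open>
  Each summand of the Kronecker sum pairs the distance kernel of one factor with the constant
  kernel \<open>1\<close> on the other, and the form of the constant kernel at \<open>a\<close> is \<open>\<langle>1, a\<rangle>\<^sup>2\<close>.
\<close>

lemma quadratic_form_tensor:
  assumes G1: "pair_graph G1" "Digraph_Component.connected (with_proj G1)"
    and G2: "pair_graph G2" "Digraph_Component.connected (with_proj G2)"
  defines "P \<equiv> cartesian_product G1 G2"
  shows "inner_on (pverts P) (tensor a b) (dist_op P (tensor a b)) =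
    inner_on (pverts G1) a (dist_op G1 a) * (inner_on (pverts G2) (\<lambda>_. 1) b)\<^sup>2 +
    (inner_on (pverts G1) (\<lambda>_. 1) a)\<^sup>2 * inner_on (pverts G2) b (dist_op G2 b)"
proof -
  let ?V = "pverts G1" and ?W = "pverts G2"
  let ?sa = "inner_on ?V (\<lambda>_. 1) a" and ?sb = "inner_on ?W (\<lambda>_. 1) b"
  have op: "dist_op P (tensor a b) (u, v) = ?sb * tensor (dist_op G1 a) (\<lambda>_. 1) (u, v)
      + ?sa * tensor (\<lambda>_. 1) (dist_op G2 b) (u, v)" if "u \<in> ?V" "v \<in> ?W" for u v
  proof -
    have "dist_op P (tensor a b) (u, v) =
        (\<Sum>u'\<in>?V. \<Sum>v'\<in>?W. (graph_dist G1 u u' + graph_dist G2 v v') * (a u' * b v'))"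
      unfolding dist_op_def P_def pverts_cartesian_product sum.cartesian_product
      using that by (intro sum.cong refl) (auto simp: graph_dist_cartesian_product[OF G1 G2] tensor_def)
    also have "\<dots> = (\<Sum>u'\<in>?V. \<Sum>v'\<in>?W. (graph_dist G1 u u' * a u') * b v')
        + (\<Sum>u'\<in>?V. \<Sum>v'\<in>?W. a u' * (graph_dist G2 v v' * b v'))"
      by (simp add: sum.distrib algebra_simps)
    also have "\<dots> = dist_op G1 a u * ?sb + ?sa * dist_op G2 b v"
      by (simp add: dist_op_def inner_on_def sum_product)
    finally show ?thesis by (simp add: tensor_def mult_ac)
  qed
  have "inner_on (pverts P) (tensor a b) (dist_op P (tensor a b)) =
      inner_on (?V \<times> ?W) (tensor a b) (\<lambda>x. ?sb * tensor (dist_op G1 a) (\<lambda>_. 1) x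
        + ?sa * tensor (\<lambda>_. 1) (dist_op G2 b) x)"
    using op by (auto simp: inner_on_def P_def intro!: sum.cong)
  also have "\<dots> = ?sb * (inner_on ?V a (dist_op G1 a) * inner_on ?W b (\<lambda>_. 1))
      + ?sa * (inner_on ?V a (\<lambda>_. 1) * inner_on ?W b (dist_op G2 b))"
    by (simp only: inner_on_add_right inner_on_scale_right inner_on_tensor)
  also have "\<dots> = inner_on ?V a (dist_op G1 a) * ?sb\<^sup>2 + ?sa\<^sup>2 * inner_on ?W b (dist_op G2 b)"
    by (simp add: inner_on_def power2_eq_square mult_ac)
  finally show ?thesis .
qed

lemma tensor_feasible:
  assumes "inner_on (pverts G1) a a = 1" "inner_on (pverts G2) b b = 1"
    and "inner_on (pverts G1) (\<lambda>_. 1) a = 0 \<or> inner_on (pverts G2) (\<lambda>_. 1) b = 0"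
  shows "tensor a b \<in> qec_feasible (cartesian_product G1 G2)"
proof -
  have "(\<lambda>_. 1) = tensor (\<lambda>_::'a. 1) (\<lambda>_::'b. 1)"
    by (auto simp: tensor_def)
  then show ?thesis
    using assms by (auto simp: qec_feasible_def inner_on_tensor)
qed

lemma inner_on_constant_unit_vector:
  fixes V :: "'a set"
  assumes "card V \<ge> 1"
  defines "b \<equiv> \<lambda>_::'a. 1 / sqrt (real (card V))"
  shows "inner_on V b b = 1" "(inner_on V (\<lambda>_. 1) b)\<^sup>2 = real (card V)"
proof -
  show "inner_on V b b = 1"
    using assms(1) by (simp add: inner_on_def b_def)
  have "inner_on V (\<lambda>_. 1) b = sqrt (real (card V))"
    using assms(1) by (simp add: inner_on_def b_def real_div_sqrt)
  then show "(inner_on V (\<lambda>_. 1) b)\<^sup>2 = real (card V)"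
    by simp
qed

section \<open>Comparing the embedding constants\<close>

text \<open>
  Proving the bound for each feasible function and dividing by \<open>c\<close> also covers an empty feasible
  set, where \<open>QEC G = -\<infinity>\<close>.
\<close>

lemma scaled_QEC_leI:
  assumes "c > 0"
    and "\<And>f. f \<in> qec_feasible G \<Longrightarrow> ereal (c * inner_on (pverts G) f (dist_op G f)) \<le> B"
  shows "ereal c * QEC G \<le> B"
proof -
  have "QEC G \<le> B / ereal c"
    unfolding QEC_def
  proof (rule SUP_least)
    fix f assume "f \<in> qec_feasible G"
    then show "ereal (inner_on (pverts G) f (dist_op G f)) \<le> B / ereal c"
      using assms by (simp add: ereal_le_divide_pos)
  qed
  then show ?thesis
    using \<open>c > 0\<close> by (simp add: ereal_le_divide_pos)
qed

theorem proposition1p3: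
  fixes G1 :: "'a pair_pre_digraph" and G2 :: "'b pair_pre_digraph" and m n :: nat
  assumes "pair_graph G1" and "Digraph_Component.connected (with_proj G1)"
    and "pair_graph G2" and "Digraph_Component.connected (with_proj G2)"
    and "card (pverts G1) = m" and "m \<ge> 1"
    and "card (pverts G2) = n" and "n \<ge> 1"
  shows "max (ereal (real n) * QEC G1) (ereal (real m) * QEC G2)
         \<le> QEC (cartesian_product G1 G2)"
proof (rule max.boundedI)
  note form = quadratic_form_tensor[OF assms(1-4)]
  have upper: "ereal (inner_on (pverts (cartesian_product G1 G2)) F
      (dist_op (cartesian_product G1 G2) F)) \<le> QEC (cartesian_product G1 G2)"
    if "F \<in> qec_feasible (cartesian_product G1 G2)" for F
    unfolding QEC_def using that by (rule SUP_upper)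
  show "ereal (real n) * QEC G1 \<le> QEC (cartesian_product G1 G2)"
  proof (rule scaled_QEC_leI)
    fix a assume "a \<in> qec_feasible G1"
    then have a: "inner_on (pverts G1) a a = 1" "inner_on (pverts G1) (\<lambda>_. 1) a = 0"
      by (auto simp: qec_feasible_def)
    define b :: "'b \<Rightarrow> real" where "b = (\<lambda>_. 1 / sqrt (real n))"
    have b: "inner_on (pverts G2) b b = 1" "(inner_on (pverts G2) (\<lambda>_. 1) b)\<^sup>2 = real n"
      using inner_on_constant_unit_vector[of "pverts G2"] assms(7,8) by (simp_all add: b_def)
    show "ereal (real n * inner_on (pverts G1) a (dist_op G1 a)) \<le> QEC (cartesian_product G1 G2)"
      using upper[OF tensor_feasible, of a b] a b by (simp only: form) (simp add: mult.commute)
  qed (use assms(8) in simp)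
  show "ereal (real m) * QEC G2 \<le> QEC (cartesian_product G1 G2)"
  proof (rule scaled_QEC_leI)
    fix b assume "b \<in> qec_feasible G2"
    then have b: "inner_on (pverts G2) b b = 1" "inner_on (pverts G2) (\<lambda>_. 1) b = 0"
      by (auto simp: qec_feasible_def)
    define a :: "'a \<Rightarrow> real" where "a = (\<lambda>_. 1 / sqrt (real m))"
    have a: "inner_on (pverts G1) a a = 1" "(inner_on (pverts G1) (\<lambda>_. 1) a)\<^sup>2 = real m"
      using inner_on_constant_unit_vector[of "pverts G1"] assms(5,6) by (simp_all add: a_def)
    show "ereal (real m * inner_on (pverts G2) b (dist_op G2 b)) \<le> QEC (cartesian_product G1 G2)"
      using upper[OF tensor_feasible, of a b] a b by (simp only: form) simp
  qed (use assms(6) in simp)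
qed

end
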